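(* Every admissible graph $G$ satisfies $\mathrm{Maj}'(G)\le 5$. That is, for every admissible graph $G$ there is an edge-coloring $c:E(G)\to\{1,2,3,4,5\}$ such that for every edge $uv\in E(G)$ and every color $i\in\{1,2,3,4,5\}$, $$\bigl|\{f\in E(G): |\{u,v\}\cap f|=1,\ c(f)=i\}\bigr|\le \frac{d(u)+d(v)}{2}-1 .$$
   Context: Graphs are finite and simple; $d(v)$ denotes the degree of the vertex $v$ in $G$. An edge-coloring is any map $c:E(G)\to C$ to a set $C$ of colors (not necessarily proper). It is a strong majority edge-coloring if for every edge $uv\in E(G)$ and every color $i\in C$, $$\bigl|\{f\in E(G): |\{u,v\}\cap f|=1,\ c(f)=i\}\bigr|\le \frac{d(u)+d(v)}{2}-1,$$ i.e. for every edge $e$ and every color $i$, at most half of the edges adjacent to $e$ (sharing exactly one endpoint with $e$) have color $i$. The least number of colors in a strong majority edge-coloring of $G$ is denoted $\mathrm{Maj}'(G)$. A graph $G$ is admissible if it has no pendant path of length two, i.e. it contains no path $xyz$ (three distinct vertices with $xy,yz\in E(G)$) with $d(x)=1$ and $d(y)=2$. *)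

theory Defs
  imports Complex_Main "HOL-Library.Extended_Nat"
begin

locale finite_simple_graph =
  fixes V :: "'a set" and E :: "'a set set"
  assumes finite_vertices: "finite V"
    and edge_subset: "e \<in> E \<Longrightarrow> e \<subseteq> V"
    and edge_card: "e \<in> E \<Longrightarrow> card e = 2"

definition vdegree :: "'a set set \<Rightarrow> 'a \<Rightarrow> nat" where
  "vdegree E v = card {e \<in> E. v \<in> e}"

definition admissible :: "'a set set \<Rightarrow> bool" where
  "admissible E \<longleftrightarrow>
     \<not> (\<exists>x y z. x \<noteq> y \<and> y \<noteq> z \<and> x \<noteq> z \<and> {x, y} \<in> E \<and> {y, z} \<in> E
          \<and> vdegree E x = 1 \<and> vdegree E y = 2)"

text \<open>The right-hand side of the bound is computed in the reals, so that neither the division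
  by two nor the subtraction is truncated.\<close>

definition strong_majority_edge_coloring ::
    "'a set set \<Rightarrow> 'c set \<Rightarrow> ('a set \<Rightarrow> 'c) \<Rightarrow> bool" where
  "strong_majority_edge_coloring E C c \<longleftrightarrow>
     c ` E \<subseteq> C \<and>
     (\<forall>u v. {u, v} \<in> E \<longrightarrow> (\<forall>i\<in>C.
        real (card {f \<in> E. card ({u, v} \<inter> f) = 1 \<and> c f = i})
          \<le> (real (vdegree E u) + real (vdegree E v)) / 2 - 1))"

text \<open>The least number of colors is taken in the extended naturals: it is infinite exactly when
  the graph has no strong majority edge-coloring with finitely many colors. As only the number
  of colors matters, it suffices to draw the colors from the natural numbers.\<close>

definition Maj' :: "'a set set \<Rightarrow> enat" where
  "Maj' E = Inf {enat (card C) | C :: nat set.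
     finite C \<and> (\<exists>c. strong_majority_edge_coloring E C c)}"

end

theory Submission
  imports Defs "HOL-Combinatorics.Transposition"
begin

text \<open>For an edge \<open>e\<close> at a vertex \<open>v\<close> of degree \<open>d\<close>, let \<open>n\<close> be the number of other edges at \<open>v\<close>
  of a given color, and call \<open>d - 1 - 2 n\<close> the slack of \<open>e\<close> at \<open>v\<close>; the coloring is a strong
  majority coloring iff the two slacks of every edge always have a nonnegative sum. Split every
  vertex of degree at least three into vertices of degree at most four (at most three if \<open>d = 5\<close>).
  In a proper 5-coloring of the split graph all slacks at such vertices are nonnegative, and they
  are positive if \<open>d = 4\<close> or \<open>d \<ge> 6\<close>. At a vertex of degree two the slack is -1 for the color of
  the other edge, which matters only next to a vertex of degree 2, 3 or 5. A vertex of degree two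
  between two larger vertices, one of them of degree 3 or 5, is contracted, so that its two edges get
  the same color. Edges joining two vertices of degree two are removed at first, the two neighbors
  of such an edge being made adjacent, and are colored last: each of their two ends then forbids at
  most two of the five colors. The contracted graph is a
  multigraph in which parallel edges meet a vertex of degree at most three, and it is
  5-edge-colorable by Vizing's theorem.\<close>

section \<open>Vizing's theorem\<close>

text \<open>An endpoint map on abstract items allows parallel edges; with the identity map this is
  ordinary edge-coloring. The palette has \<open>D + 1\<close> colors, as in Vizing's bound.\<close>

definition proper_coloring :: "('x \<Rightarrow> 'b set) \<Rightarrow> 'x set \<Rightarrow> nat \<Rightarrow> ('x \<Rightarrow> nat) \<Rightarrow> bool" where
  "proper_coloring ends X D c \<longleftrightarrow> c ` X \<subseteq> {..D} \<and>
     (\<forall>x\<in>X. \<forall>y\<in>X. ends x \<inter> ends y \<noteq> {} \<longrightarrow> c x = c y \<longrightarrow> x = y)"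

lemma proper_coloringD:
  assumes "proper_coloring ends X D c" "x \<in> X" "y \<in> X" "v \<in> ends x" "v \<in> ends y" "c x = c y"
  shows "x = y"
  using assms unfolding proper_coloring_def by blast

lemma proper_coloring_subset:
  "proper_coloring ends X D c \<Longrightarrow> Y \<subseteq> X \<Longrightarrow> proper_coloring ends Y D c"
  unfolding proper_coloring_def by blast

lemma proper_coloring_insert:
  assumes "proper_coloring ends X D c" "i \<le> D"
    and "\<And>y. y \<in> X \<Longrightarrow> y \<noteq> x \<Longrightarrow> ends x \<inter> ends y \<noteq> {} \<Longrightarrow> c y \<noteq> i"
  shows "proper_coloring ends (insert x X) D (c(x := i))"
  using assms unfolding proper_coloring_def by (auto simp: Int_commute)

lemma exists_avoiding_color:
  assumes "finite B" "card B \<le> D"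
  obtains i :: nat where "i \<le> D" "i \<notin> B"
proof -
  have "\<not> {..D} \<subseteq> B"
  proof
    assume "{..D} \<subseteq> B"
    then have "card {..D} \<le> card B" using assms(1) by (rule card_mono[rotated])
    then show False using assms(2) by simp
  qed
  then show thesis using that by auto
qed

section \<open>Missing colors and Kempe changes\<close>

definition missing :: "'b set set \<Rightarrow> ('b set \<Rightarrow> nat) \<Rightarrow> 'b \<Rightarrow> nat set" where
  "missing F c v = {i. \<forall>e\<in>F. v \<in> e \<longrightarrow> c e \<noteq> i}"

lemma exists_missing_color:
  assumes "finite F" "vdegree F v \<le> D"
  obtains i where "i \<le> D" "i \<in> missing F c v"
proof -
  have "card (c ` {e \<in> F. v \<in> e}) \<le> D"
    using assms card_image_le[of "{e \<in> F. v \<in> e}" c] unfolding vdegree_def by simp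
  then obtain i where "i \<le> D" "i \<notin> c ` {e \<in> F. v \<in> e}"
    using assms(1) exists_avoiding_color[of "c ` {e \<in> F. v \<in> e}" D] by auto
  then show thesis using that unfolding missing_def by auto
qed

text \<open>Such a set is a union of components of the subgraph with colors \<open>a\<close> and
  \<open>b\<close>. Closure is all that a swap needs, so no paths appear.\<close>

definition kempe_closed :: "'b set set \<Rightarrow> ('b set \<Rightarrow> nat) \<Rightarrow> nat \<Rightarrow> nat \<Rightarrow> 'b set \<Rightarrow> bool" where
  "kempe_closed F c a b S \<longleftrightarrow> (\<forall>e\<in>F. c e \<in> {a, b} \<longrightarrow> e \<inter> S = {} \<or> e \<subseteq> S)"

text \<open>The swap happens outside \<open>S\<close>: with the center of a fan in \<open>S\<close>,
  all edges at the center keep their colors.\<close>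

definition kempe_swap :: "('b set \<Rightarrow> nat) \<Rightarrow> nat \<Rightarrow> nat \<Rightarrow> 'b set \<Rightarrow> 'b set \<Rightarrow> nat" where
  "kempe_swap c a b S e = (if e \<inter> S = {} then transpose a b (c e) else c e)"

lemma transpose_neq: "x \<noteq> a \<Longrightarrow> x \<noteq> b \<Longrightarrow> transpose a b x = x"
  by (simp add: transpose_def)

lemma kempe_swap_outside:
  assumes "kempe_closed F c a b S" "e \<in> F" "v \<in> e" "v \<notin> S"
  shows "kempe_swap c a b S e = transpose a b (c e)"
  using assms unfolding kempe_closed_def kempe_swap_def
  by (cases "c e \<in> {a, b}") (auto simp: transpose_neq)

lemma kempe_swap_inside:
  "v \<in> e \<Longrightarrow> v \<in> S \<Longrightarrow> kempe_swap c a b S e = c e"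
  unfolding kempe_swap_def by auto

text \<open>At a vertex shared by two edges either both colors stay or both go through the same
  injective map, so equal new colors come from equal old ones.\<close>

lemma proper_coloring_kempe_swap:
  assumes "proper_coloring (\<lambda>e. e) F D c" "kempe_closed F c a b S" "a \<le> D" "b \<le> D"
  shows "proper_coloring (\<lambda>e. e) F D (kempe_swap c a b S)"
  unfolding proper_coloring_def
proof (intro conjI ballI impI)
  show "kempe_swap c a b S ` F \<subseteq> {..D}"
    using assms unfolding proper_coloring_def kempe_swap_def by (auto simp: transpose_def)
next
  fix e f assume ef: "e \<in> F" "f \<in> F" "e \<inter> f \<noteq> {}" "kempe_swap c a b S e = kempe_swap c a b S f"
  then obtain v where v: "v \<in> e" "v \<in> f" by blast
  have "c e = c f"
  proof (cases "v \<in> S")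
    case True
    then show ?thesis using ef v by (simp add: kempe_swap_inside)
  next
    case False
    then have "transpose a b (c e) = transpose a b (c f)"
      using ef v kempe_swap_outside[OF assms(2)] by simp
    then show ?thesis by (simp add: inj_eq)
  qed
  then show "e = f" using proper_coloringD[OF assms(1) ef(1,2) v] by blast
qed

lemma missing_kempe_swap_inside:
  "v \<in> S \<Longrightarrow> missing F (kempe_swap c a b S) v = missing F c v"
  unfolding missing_def by (auto simp: kempe_swap_inside)

lemma missing_kempe_swap_outside:
  assumes "kempe_closed F c a b S" "v \<notin> S" "i \<in> missing F c v"
  shows "transpose a b i \<in> missing F (kempe_swap c a b S) v"
  using assms kempe_swap_outside[OF assms(1)] unfolding missing_def
  by (auto simp: transpose_eq_iff)

text \<open>A connected two-colored subgraph on n vertices has at least n - 1 edges, and all its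
  degrees are at most two, so that at most two of its vertices have degree less than two.\<close>

lemma kempe_separation:
  fixes F :: "'b set set"
  assumes "finite F" "\<And>e. e \<in> F \<Longrightarrow> card e = 2" "proper_coloring (\<lambda>e. e) F D c"
    and "a \<noteq> b" "distinct [p, q, r]"
    and miss: "\<And>x. x \<in> {p, q, r} \<Longrightarrow> a \<in> missing F c x \<or> b \<in> missing F c x"
  obtains S where "kempe_closed F c a b S" "p \<in> S" "q \<notin> S \<or> r \<notin> S"
proof -
  define M where "M = {e \<in> F. c e \<in> {a, b}}"
  define inner where "inner T = {e \<in> M. e \<subseteq> T}" for T
  define U where "U = insert p (\<Union>F)"
  have finM: "finite M" using assms(1) unfolding M_def by simp
  have "finite e" if "e \<in> F" for e using assms(2)[OF that] card.infinite by fastforce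
  then have finU: "finite U" using assms(1) unfolding U_def by simp
  have fin_inner: "finite (inner T)" for T using finM unfolding inner_def by simp
  \<comment> \<open>Connectivity is replaced by the edge count it implies. A largest such set
    containing \<open>p\<close> plays the role of the Kempe component of \<open>p\<close>.\<close>
  define Q where "Q T \<longleftrightarrow> p \<in> T \<and> T \<subseteq> U \<and> card T \<le> card (inner T) + 1" for T
  have "Q {p}" unfolding Q_def U_def by simp
  moreover have "\<forall>T. Q T \<longrightarrow> card T < Suc (card U)"
    using finU by (simp add: Q_def card_mono less_Suc_eq_le)
  ultimately have "\<exists>T. Q T \<and> (\<forall>T'. Q T' \<longrightarrow> card T' \<le> card T)"
    by (rule ex_has_greatest_nat)
  then obtain T where T: "Q T" and max: "\<And>T'. Q T' \<Longrightarrow> card T' \<le> card T" by auto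
  have finT: "finite T" using T finU finite_subset unfolding Q_def by blast
  \<comment> \<open>An edge of color \<open>a\<close> or \<open>b\<close> leaving \<open>T\<close>
    could be added together with its outer end: one more vertex and at least one more inner edge,
    against maximality.\<close>
  have closed: "kempe_closed F c a b T"
    unfolding kempe_closed_def
  proof (intro ballI impI, rule ccontr)
    fix e assume e: "e \<in> F" "c e \<in> {a, b}" "\<not> (e \<inter> T = {} \<or> e \<subseteq> T)"
    then obtain x y where xy: "x \<in> e" "x \<in> T" "y \<in> e" "y \<notin> T" by blast
    have "e = {x, y}" using assms(2)[OF e(1)] xy by (auto simp: card_2_iff)
    then have "insert e (inner T) \<subseteq> inner (insert y T)"
      using e xy unfolding inner_def M_def by auto
    then have "card (insert e (inner T)) \<le> card (inner (insert y T))"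
      using fin_inner card_mono by blast
    moreover have "e \<notin> inner T" using xy unfolding inner_def by blast
    ultimately have "card (inner T) + 1 \<le> card (inner (insert y T))"
      using fin_inner by simp
    then have "Q (insert y T)" using T xy e finT unfolding Q_def U_def by auto
    then show False using max[of "insert y T"] xy finT by simp
  qed
  have "q \<notin> T \<or> r \<notin> T"
  proof (rule ccontr)
    assume "\<not> ?thesis"
    then have sub: "{p, q, r} \<subseteq> T" using T unfolding Q_def by blast
    have deg: "card {e \<in> inner T. x \<in> e} + (if x \<in> {p, q, r} then 1 else 0) \<le> 2" for x
    proof -
      let ?A = "{e \<in> inner T. x \<in> e}"
      have inj: "inj_on c ?A"
        using proper_coloringD[OF assms(3)] unfolding inj_on_def inner_def M_def by blast
      have im: "c ` ?A \<subseteq> {a, b}" unfolding inner_def M_def by auto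
      show ?thesis
      proof (cases "x \<in> {p, q, r}")
        case True
        have "c ` ?A \<subseteq> {a} \<or> c ` ?A \<subseteq> {b}"
          using miss[OF True] im unfolding missing_def inner_def M_def by blast
        then have "card (c ` ?A) \<le> 1"
          by (auto dest: card_mono[rotated])
        then show ?thesis using True card_image[OF inj] by simp
      next
        case False
        have "card (c ` ?A) \<le> card {a, b}" using im by (intro card_mono) auto
        then show ?thesis using False card_image[OF inj] assms(4) by simp
      qed
    qed
    \<comment> \<open>Double counting of incidences: with all three vertices in \<open>T\<close>,
      twice the number of inner edges plus 3 is at most \<open>2 * card T\<close>, which contradicts
      \<open>Q T\<close>.\<close>
    have "2 * card (inner T) = (\<Sum>e\<in>inner T. card e)"
      using assms(2) unfolding inner_def M_def by (simp add: sum.neutral)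
    also have "\<dots> = (\<Sum>e\<in>inner T. \<Sum>x\<in>T. if x \<in> e then 1 else 0)"
    proof (rule sum.cong[OF refl])
      fix e assume "e \<in> inner T"
      then have "e = {x \<in> T. x \<in> e}" unfolding inner_def by blast
      then show "card e = (\<Sum>x\<in>T. if x \<in> e then 1 else 0)"
        using finT by (simp add: sum.If_cases Int_def)
    qed
    also have "\<dots> = (\<Sum>x\<in>T. \<Sum>e\<in>inner T. if x \<in> e then 1 else 0)" by (rule sum.swap)
    also have "\<dots> = (\<Sum>x\<in>T. card {e \<in> inner T. x \<in> e})"
      using fin_inner by (simp add: sum.If_cases Int_def)
    finally have "2 * card (inner T) + (\<Sum>x\<in>T. if x \<in> {p, q, r} then 1 else 0)
        = (\<Sum>x\<in>T. card {e \<in> inner T. x \<in> e} + (if x \<in> {p, q, r} then 1 else 0))"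
      by (simp add: sum.distrib)
    also have "\<dots> \<le> (\<Sum>x\<in>T. 2)" by (rule sum_mono) (rule deg)
    finally have "2 * card (inner T) + card (T \<inter> {p, q, r}) \<le> 2 * card T"
      using finT by (simp add: sum.If_cases Int_def)
    moreover have "T \<inter> {p, q, r} = {p, q, r}" using sub by blast
    moreover have "card {p, q, r} = 3" using assms(5) by simp
    ultimately show False using T unfolding Q_def by simp
  qed
  with closed T that show thesis unfolding Q_def by blast
qed

section \<open>Vizing fans\<close>

definition fan :: "'b set set \<Rightarrow> 'b \<Rightarrow> ('b set \<Rightarrow> nat) \<Rightarrow> 'b list \<Rightarrow> bool" where
  "fan E v c ws \<longleftrightarrow> ws \<noteq> [] \<and> distinct ws \<and> v \<notin> set ws \<and> (\<forall>w\<in>set ws. {v, w} \<in> E) \<and>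
     (\<forall>i. Suc i < length ws \<longrightarrow>
        c {v, ws ! Suc i} \<in> missing (E - {{v, ws ! 0}}) c (ws ! i))"

text \<open>Every fan edge takes the color of its successor and the last one takes \<open>i\<close>.
  Each step of the induction moves the uncolored edge one place along the fan, and the tail remains
  a fan.\<close>

lemma fan_rotation:
  assumes "fan E v c ws" "proper_coloring (\<lambda>e. e) (E - {{v, ws ! 0}}) D c" "i \<le> D"
    and "i \<in> missing (E - {{v, ws ! 0}}) c v"
    and "i \<in> missing (E - {{v, ws ! 0}}) c (last ws)"
  shows "\<exists>c'. proper_coloring (\<lambda>e. e) E D c'"
  using assms
proof (induction ws arbitrary: c)
  case Nil
  then show ?case by (simp add: fan_def)
next
  case (Cons w ws)
  let ?e = "{v, w}"
  let ?F = "E - {?e}"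
  have eE: "?e \<in> E" using Cons.prems(1) unfolding fan_def by simp
  show ?case
  proof (cases ws)
    case Nil
    have "proper_coloring (\<lambda>e. e) (insert ?e ?F) D (c(?e := i))"
      using Cons.prems Nil
      by (intro proper_coloring_insert) (auto simp: missing_def)
    then show ?thesis using eE by (metis insert_Diff)
  next
    case (Cons w' ws')
    let ?e' = "{v, w'}"
    define c' where "c' = c(?e := c ?e')"
    have ne: "w \<noteq> w'" "v \<noteq> w" "v \<noteq> w'" "w \<notin> set ws" "v \<notin> set ws" "distinct ws"
      and e'E: "?e' \<in> ?F" and wsE: "\<forall>w\<in>set ws. {v, w} \<in> E"
      using Cons.prems(1) Cons unfolding fan_def by (auto simp: doubleton_eq_iff)
    have step: "c {v, (w # ws) ! Suc j} \<in> missing ?F c ((w # ws) ! j)"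
      if "Suc j < length (w # ws)" for j
      using Cons.prems(1) that unfolding fan_def by simp
    have w_missing: "c ?e' \<in> missing ?F c w" using step[of 0] Cons by simp
    have "proper_coloring (\<lambda>e. e) (insert ?e (?F - {?e'})) D c'"
      unfolding c'_def
    proof (rule proper_coloring_insert)
      show "proper_coloring (\<lambda>e. e) (?F - {?e'}) D c"
        using Cons.prems(2) by (auto intro: proper_coloring_subset)
      show "c ?e' \<le> D" using Cons.prems(2) e'E unfolding proper_coloring_def by auto
      fix f assume f: "f \<in> ?F - {?e'}" "?e \<inter> f \<noteq> {}"
      show "c f \<noteq> c ?e'"
      proof (cases "v \<in> f")
        case True
        then show ?thesis
          using f e'E Cons.prems(2) proper_coloringD[of "\<lambda>e. e" ?F D c f ?e' v] by auto
      next
        case False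
        then show ?thesis using f w_missing unfolding missing_def by auto
      qed
    qed
    moreover have "insert ?e (?F - {?e'}) = E - {?e'}"
      using eE ne by (auto simp: doubleton_eq_iff)
    ultimately have proper': "proper_coloring (\<lambda>e. e) (E - {{v, ws ! 0}}) D c'"
      using Cons by simp
    \<comment> \<open>The edge that changes its color and the edge that becomes uncolored affect no
      vertex of the tail adversely: the first does not meet the tail, and uncoloring the second can
      only enlarge the set of missing colors.\<close>
    have transfer: "k \<in> missing (E - {{v, ws ! 0}}) c' x"
      if "k \<in> missing ?F c x" "x \<in> set ws" for k x
      using that ne Cons unfolding missing_def c'_def by auto
    have "fan E v c' ws"
      unfolding fan_def
    proof (intro conjI allI impI)
      fix j assume j: "Suc j < length ws"
      then have "{v, ws ! Suc j} \<noteq> ?e"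
        using ne nth_mem[of "Suc j" ws] by (auto simp: doubleton_eq_iff)
      then have "c' {v, ws ! Suc j} = c {v, ws ! Suc j}" unfolding c'_def by simp
      then show "c' {v, ws ! Suc j} \<in> missing (E - {{v, ws ! 0}}) c' (ws ! j)"
        using step[of "Suc j"] j by (auto intro: transfer)
    qed (use ne wsE Cons in auto)
    moreover have "i \<in> missing (E - {{v, ws ! 0}}) c' v"
      using Cons.prems(4) e'E Cons unfolding missing_def c'_def by auto
    moreover have "i \<in> missing (E - {{v, ws ! 0}}) c' (last ws)"
      using Cons.prems(5) Cons by (intro transfer) auto
    ultimately show ?thesis using Cons.IH proper' Cons.prems(3) by blast
  qed
qed

text \<open>Take a longest fan, a color \<open>a\<close> missing at \<open>v\<close> and a color
  \<open>b\<close> missing at the last fan vertex. If \<open>b\<close> is present at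
  \<open>v\<close>, its edge leads into the fan, and \<open>b\<close> is missing at the predecessor
  \<open>q\<close> as well. One of \<open>q\<close> and the last vertex can be separated from
  \<open>v\<close>; swapping there makes \<open>a\<close> missing at both \<open>v\<close> and that
  vertex, and the fan up to it can be rotated.\<close>

lemma vizing_extension:
  fixes E :: "'b set set"
  assumes "finite E" and card2: "\<And>e. e \<in> E \<Longrightarrow> card e = 2" and deg: "\<And>v. vdegree E v \<le> D"
    and e0: "{v, w0} \<in> E" and proper: "proper_coloring (\<lambda>e. e) (E - {{v, w0}}) D c"
  shows "\<exists>c'. proper_coloring (\<lambda>e. e) E D c'"
proof -
  let ?F = "E - {{v, w0}}"
  have finF: "finite ?F" using assms(1) by simp
  have degF: "vdegree ?F x \<le> D" for x
    using deg[of x] card_mono[of "{e \<in> E. x \<in> e}" "{e \<in> ?F. x \<in> e}"] assms(1)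
    unfolding vdegree_def by fastforce
  have "v \<noteq> w0" using card2[OF e0] by auto
  define Q where "Q ws \<longleftrightarrow> fan E v c ws \<and> ws ! 0 = w0" for ws
  have "finite e" if "e \<in> E" for e using card2[OF that] card.infinite by fastforce
  then have finU: "finite (\<Union>E)" using assms(1) by simp
  have "Q [w0]" using e0 \<open>v \<noteq> w0\<close> unfolding Q_def fan_def by simp
  moreover have "\<forall>ws. Q ws \<longrightarrow> length ws < Suc (card (\<Union>E))"
  proof (intro allI impI)
    fix ws assume "Q ws"
    then have "distinct ws" "set ws \<subseteq> \<Union>E" unfolding Q_def fan_def by auto
    then show "length ws < Suc (card (\<Union>E))"
      using finU card_mono distinct_card less_Suc_eq_le by metis
  qed
  ultimately have "\<exists>ws. Q ws \<and> (\<forall>us. Q us \<longrightarrow> length us \<le> length ws)"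
    by (rule ex_has_greatest_nat)
  then obtain ws where "Q ws" and max: "\<And>us. Q us \<Longrightarrow> length us \<le> length ws" by auto
  then have fan: "fan E v c ws" and ws0: "ws ! 0 = w0" unfolding Q_def by auto
  have ne: "ws \<noteq> []" and dist: "distinct ws" and vws: "v \<notin> set ws"
    and wsE: "\<And>w. w \<in> set ws \<Longrightarrow> {v, w} \<in> E"
    and step: "\<And>i. Suc i < length ws \<Longrightarrow> c {v, ws ! Suc i} \<in> missing ?F c (ws ! i)"
    using fan ws0 unfolding fan_def by auto
  obtain a where a: "a \<le> D" "a \<in> missing ?F c v" using exists_missing_color[OF finF degF] .
  obtain b where b: "b \<le> D" "b \<in> missing ?F c (last ws)"
    using exists_missing_color[OF finF degF] .
  show ?thesis
  proof (cases "b \<in> missing ?F c v")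
    case True
    then show ?thesis using fan_rotation[OF fan] proper b ws0 by simp
  next
    case False
    then obtain f where f: "f \<in> ?F" "v \<in> f" "c f = b" unfolding missing_def by auto
    then obtain w where w: "f = {v, w}" "v \<noteq> w"
      using card2[of f] by (auto simp: card_2_iff doubleton_eq_iff)
    \<comment> \<open>Otherwise \<open>w\<close> would prolong the fan, since the color
      \<open>b\<close> of \<open>f\<close> is missing at the last vertex.\<close>
    have "w \<in> set ws"
    proof (rule ccontr)
      assume "w \<notin> set ws"
      have "fan E v c (ws @ [w])"
        unfolding fan_def
      proof (intro conjI allI impI)
        fix i assume i: "Suc i < length (ws @ [w])"
        show "c {v, (ws @ [w]) ! Suc i} \<in> missing (E - {{v, (ws @ [w]) ! 0}}) c ((ws @ [w]) ! i)"
        proof (cases "Suc i < length ws")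
          case True
          then show ?thesis using step[of i] ws0 ne by (simp add: nth_append)
        next
          case False
          then have "Suc i = length ws" using i by simp
          then show ?thesis using b(2) f w ws0 ne
            by (simp add: nth_append last_conv_nth flip: \<open>Suc i = length ws\<close>)
        qed
      qed (use \<open>w \<notin> set ws\<close> dist vws wsE f w in auto)
      then have "Q (ws @ [w])" using ws0 ne unfolding Q_def by (simp add: nth_append)
      then show False using max[of "ws @ [w]"] by simp
    qed
    then obtain j' where j': "j' < length ws" "w = ws ! j'" by (metis in_set_conv_nth)
    have "j' \<noteq> 0" using j' f w ws0 by auto
    then obtain j where j: "j' = Suc j" by (cases j') auto
    define q where "q = ws ! j"
    have bq: "b \<in> missing ?F c q" using step[of j] j j' f w q_def by simp
    have qset: "q \<in> set ws" using j j' unfolding q_def by simp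
    have "q \<noteq> last ws"
      using dist j j' ne by (simp add: q_def last_conv_nth nth_eq_iff_index_eq)
    moreover have "q \<noteq> v" "last ws \<noteq> v" using qset vws ne by auto
    ultimately have dist3: "distinct [v, q, last ws]" by auto
    have "a \<noteq> b" using a(2) f unfolding missing_def by auto
    obtain S where S: "kempe_closed ?F c a b S" "v \<in> S" "q \<notin> S \<or> last ws \<notin> S"
      using kempe_separation[OF finF _ proper \<open>a \<noteq> b\<close> dist3] card2 a b bq by auto
    \<comment> \<open>The fan is cut at \<open>q\<close> if \<open>q\<close> lies outside
      \<open>S\<close>, and otherwise kept whole. The last clause records that a segment reaching
      past \<open>q\<close> occurs only with \<open>q\<close> in \<open>S\<close>.\<close>
    obtain m where m: "m < length ws" "ws ! m \<notin> S" "b \<in> missing ?F c (ws ! m)"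
      "Suc j \<le> m \<Longrightarrow> q \<in> S"
    proof (cases "q \<in> S")
      case True
      then show thesis using that[of "length ws - 1"] S b ne by (simp add: last_conv_nth)
    next
      case False
      then show thesis using that[of j] bq j j' q_def by simp
    qed
    let ?c = "kempe_swap c a b S"
    let ?us = "take (Suc m) ws"
    have us0: "?us ! 0 = w0" using ws0 by simp
    have last_us: "last ?us = ws ! m" using m(1) by (simp add: take_Suc_conv_app_nth)
    have sub: "set ?us \<subseteq> set ws" by (rule set_take_subset)
    have "fan E v ?c ?us"
      unfolding fan_def us0
    proof (intro conjI allI impI)
      fix i assume "Suc i < length ?us"
      then have i: "Suc i \<le> m" "Suc i < length ws" by auto
      let ?g = "c {v, ws ! Suc i}"
      have gF: "{v, ws ! Suc i} \<in> ?F"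
        using wsE i ws0 dist vws nth_mem[OF i(2)]
        by (auto simp: doubleton_eq_iff nth_eq_iff_index_eq[of ws "Suc i" 0] ne simp flip: ws0)
      \<comment> \<open>The swap preserves the fan condition: \<open>a\<close> does not occur at
        \<open>v\<close>, and \<open>b\<close> occurs there only on \<open>f\<close>, whose
        predecessor \<open>q\<close> is in \<open>S\<close> whenever \<open>f\<close> belongs to the
        segment.\<close>
      have "?g \<noteq> a" using a(2) gF unfolding missing_def by auto
      have swap: "?c {v, ws ! Suc i} = ?g" using kempe_swap_inside[OF _ S(2)] by simp
      have "?g \<in> missing ?F ?c (ws ! i)"
      proof (cases "ws ! i \<in> S")
        case True
        then show ?thesis using step[OF i(2)] by (simp add: missing_kempe_swap_inside)
      next
        case False
        then have "i \<noteq> j" using m(4) i(1) q_def by auto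
        then have "{v, ws ! Suc i} \<noteq> f"
          using w j j' i dist by (auto simp: doubleton_eq_iff nth_eq_iff_index_eq)
        then have "?g \<noteq> b" using proper_coloringD[OF proper gF f(1)] f by auto
        then show ?thesis
          using missing_kempe_swap_outside[OF S(1) False step[OF i(2)]] \<open>?g \<noteq> a\<close>
          by (simp add: transpose_neq)
      qed
      then show "?c {v, ?us ! Suc i} \<in> missing ?F ?c (?us ! i)"
        using swap i by simp
    qed (use m ne dist vws wsE sub in \<open>auto dest: in_set_takeD\<close>)
    moreover have "a \<in> missing ?F ?c v" using a(2) S(2) by (simp add: missing_kempe_swap_inside)
    moreover have "a \<in> missing ?F ?c (last ?us)"
      using missing_kempe_swap_outside[OF S(1) m(2,3)] last_us by simp
    moreover have "proper_coloring (\<lambda>e. e) ?F D ?c"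
      using proper_coloring_kempe_swap[OF proper S(1)] a b by simp
    ultimately show ?thesis using fan_rotation[of E v ?c ?us D a] a(1) us0 by simp
  qed
qed

text \<open>Edges are inserted one at a time, each insertion being repaired by a fan
  argument.\<close>

theorem vizing:
  fixes E :: "'b set set"
  assumes "finite E" "\<And>e. e \<in> E \<Longrightarrow> card e = 2" "\<And>v. vdegree E v \<le> D"
  shows "\<exists>c. proper_coloring (\<lambda>e. e) E D c"
  using assms
proof (induction E rule: finite_induct)
  case empty
  then show ?case by (simp add: proper_coloring_def)
next
  case (insert e F)
  have "vdegree F v \<le> D" for v
    using insert.prems(2)[of v] card_mono[of "{f \<in> insert e F. v \<in> f}" "{f \<in> F. v \<in> f}"]
      insert.hyps(1) unfolding vdegree_def by fastforce
  then obtain c where c: "proper_coloring (\<lambda>e. e) F D c" using insert by auto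
  obtain v w where e: "e = {v, w}" using insert.prems(1)[of e] by (auto simp: card_2_iff)
  have "insert e F - {e} = F" using insert.hyps by auto
  then show ?case
    using vizing_extension[of "insert e F" D v w c] insert c e by auto
qed

section \<open>Multigraphs of maximum degree four\<close>

text \<open>A pair of parallel edges meeting a vertex of degree at most three has at most three
  neighboring edges, so that it can be colored last; without such pairs Vizing's theorem
  applies.\<close>

lemma multigraph_proper_coloring:
  fixes ends :: "'x \<Rightarrow> 'b set"
  assumes "finite X" "\<And>x. x \<in> X \<Longrightarrow> card (ends x) = 2"
    and "\<And>q. card {x \<in> X. q \<in> ends x} \<le> 4"
    and "\<And>x y. x \<in> X \<Longrightarrow> y \<in> X \<Longrightarrow> x \<noteq> y \<Longrightarrow> ends x = ends y
      \<Longrightarrow> \<exists>q\<in>ends x. card {z \<in> X. q \<in> ends z} \<le> 3"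
  shows "\<exists>c. proper_coloring ends X 4 c"
  using assms
proof (induction X rule: finite_psubset_induct)
  case (psubset X)
  show ?case
  proof (cases "inj_on ends X")
    case True
    have "vdegree (ends ` X) q \<le> 4" for q
    proof -
      have "{e \<in> ends ` X. q \<in> e} = ends ` {x \<in> X. q \<in> ends x}" by blast
      then have "vdegree (ends ` X) q \<le> card {x \<in> X. q \<in> ends x}"
        unfolding vdegree_def using psubset.hyps by (simp add: card_image_le)
      then show ?thesis using psubset.prems(2)[of q] by linarith
    qed
    then obtain c where c: "proper_coloring (\<lambda>e. e) (ends ` X) 4 c"
      using vizing[of "ends ` X" 4] psubset.hyps psubset.prems(1) by auto
    have "proper_coloring ends X 4 (c \<circ> ends)"
      using c inj_onD[OF True] unfolding proper_coloring_def by (auto simp: image_subset_iff)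
    then show ?thesis by blast
  next
    case False
    then obtain x y where xy: "x \<in> X" "y \<in> X" "x \<noteq> y" "ends x = ends y"
      unfolding inj_on_def by blast
    then obtain q where q: "q \<in> ends x" "card {z \<in> X. q \<in> ends z} \<le> 3"
      using psubset.prems(3) by blast
    obtain p where ends: "ends x = {q, p}"
      using psubset.prems(1)[OF xy(1)] q(1) by (auto simp: card_2_iff doubleton_eq_iff)
    let ?Y = "X - {x, y}"
    have sub: "card {z \<in> ?Y. r \<in> ends z} \<le> card {z \<in> X. r \<in> ends z}" for r
      using psubset.hyps by (intro card_mono) auto
    have "\<exists>c. proper_coloring ends ?Y 4 c"
    proof (rule psubset.IH)
      show "?Y \<subset> X" using xy by blast
      show "card (ends z) = 2" if "z \<in> ?Y" for z using psubset.prems(1) that by simp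
      show "card {z \<in> ?Y. r \<in> ends z} \<le> 4" for r
        using sub psubset.prems(2) order_trans by blast
      show "\<exists>r\<in>ends u. card {z \<in> ?Y. r \<in> ends z} \<le> 3"
        if "u \<in> ?Y" "w \<in> ?Y" "u \<noteq> w" "ends u = ends w" for u w
        using psubset.prems(3)[of u w] that sub by (meson DiffD1 order_trans)
    qed
    then obtain c where c: "proper_coloring ends ?Y 4 c" by blast
    define N where "N = {z \<in> ?Y. p \<in> ends z} \<union> {z \<in> ?Y. q \<in> ends z}"
    have drop2: "card {z \<in> ?Y. r \<in> ends z} + 2 \<le> card {z \<in> X. r \<in> ends z}"
      if "r \<in> ends x" for r
    proof -
      have "insert x (insert y {z \<in> ?Y. r \<in> ends z}) \<subseteq> {z \<in> X. r \<in> ends z}"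
        using xy that by auto
      then have "card (insert x (insert y {z \<in> ?Y. r \<in> ends z})) \<le> card {z \<in> X. r \<in> ends z}"
        using psubset.hyps by (intro card_mono) auto
      then show ?thesis using psubset.hyps xy by simp
    qed
    \<comment> \<open>With both parallel items gone, at most 4 - 2 items remain at \<open>p\<close>
      and 3 - 2 at \<open>q\<close>.\<close>
    have "card N \<le> card {z \<in> ?Y. p \<in> ends z} + card {z \<in> ?Y. q \<in> ends z}"
      unfolding N_def by (rule card_Un_le)
    also have "\<dots> \<le> 3"
      using drop2[of p] drop2[of q] q(2) psubset.prems(2)[of p] ends by simp
    finally have "card N \<le> 3" .
    moreover have finN: "finite N" using psubset.hyps unfolding N_def by simp
    ultimately have cN: "card (c ` N) \<le> 3" using card_image_le order_trans by blast
    obtain i where i: "i \<le> 4" "i \<notin> c ` N"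
      using exists_avoiding_color[of "c ` N" 4] cN finN by auto
    \<comment> \<open>The second parallel item must also avoid \<open>i\<close>; three neighboring
      colors and \<open>i\<close> still leave one of five.\<close>
    have "card (insert i (c ` N)) \<le> 4" using cN i(2) finN by simp
    then obtain j where j: "j \<le> 4" "j \<notin> insert i (c ` N)"
      using exists_avoiding_color[of "insert i (c ` N)" 4] finN by auto
    have "proper_coloring ends (insert x ?Y) 4 (c(x := i))"
      using c i(1) by (rule proper_coloring_insert) (use i(2) ends in \<open>auto simp: N_def\<close>)
    then have "proper_coloring ends (insert y (insert x ?Y)) 4 (c(x := i, y := j))"
      using j(1)
      by (rule proper_coloring_insert) (use j(2) ends xy in \<open>auto simp: N_def\<close>)
    moreover have "insert y (insert x ?Y) = X" using xy by blast
    ultimately show ?thesis by auto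
  qed
qed

section \<open>Splitting and contracting an admissible graph\<close>

lemma doubleton_eq_card_2:
  assumes "card e = 2" "x \<in> e" "y \<in> e" "x \<noteq> y"
  shows "e = {x, y}"
  using assms by (auto simp: card_2_iff)

text \<open>Color classes are disjoint, so those filling at least half of \<open>S\<close> have
  sizes whose doubles sum to at most \<open>2 * card S\<close>. Nonemptiness makes every such color
  occur in \<open>S\<close>, whence finiteness.\<close>

lemma card_majority_colors:
  assumes "finite S" "S \<noteq> {}"
  shows "finite {i. card S \<le> 2 * card {f \<in> S. c f = i}}"
    and "card {i. card S \<le> 2 * card {f \<in> S. c f = i}} \<le> 2"
proof -
  let ?I = "{i. card S \<le> 2 * card {f \<in> S. c f = i}}"
  have pos: "card S > 0" using assms by (simp add: card_gt_0_iff)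
  have "?I \<subseteq> c ` S"
  proof
    fix i assume "i \<in> ?I"
    then have "card {f \<in> S. c f = i} \<noteq> 0" using pos by auto
    then have "{f \<in> S. c f = i} \<noteq> {}" by (metis card.empty)
    then show "i \<in> c ` S" by blast
  qed
  then show fin: "finite ?I" using assms(1) finite_subset by blast
  have "card ?I * card S = (\<Sum>i\<in>?I. card S)" by simp
  also have "\<dots> \<le> (\<Sum>i\<in>?I. 2 * card {f \<in> S. c f = i})" by (rule sum_mono) simp
  also have "\<dots> = 2 * card (\<Union>i\<in>?I. {f \<in> S. c f = i})"
    using fin assms(1) by (subst card_UN_disjoint) (auto simp: sum_distrib_left)
  also have "\<dots> \<le> 2 * card S" using assms(1) by (auto intro!: card_mono)
  finally show "card ?I \<le> 2" using pos by simp
qed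

text \<open>Number the elements and cut them into consecutive blocks of size 4 or 3; the last
  inequality bounds a ceiling. A color used at most once per block occurs at most as often as there
  are blocks, so the summands 2 and 1 express slack at least 1 and 0. Five elements form two blocks
  either way, and block size 3 meets the condition on parallel edges.\<close>

lemma exists_grouping:
  fixes A :: "'x set"
  assumes "finite A"
  shows "\<exists>g :: 'x \<Rightarrow> nat. (card A \<le> 2 \<longrightarrow> (\<forall>e. g e = 0)) \<and>
    (\<forall>j. card {e \<in> A. g e = j} \<le> (if 4 \<le> card A \<and> card A \<noteq> 5 then 4 else 3)) \<and>
    (3 \<le> card A \<longrightarrow>
      2 * card (g ` A) + (if 4 \<le> card A \<and> card A \<noteq> 5 then 2 else 1) \<le> card A)"
proof (cases "card A \<le> 2")
  case True
  then have "card {e \<in> A. P e} \<le> 2" for P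
    using assms card_mono[of A "{e \<in> A. P e}"] by fastforce
  then have "card {e \<in> A. (0 :: nat) = j} \<le> 3" for j by (meson le_trans numeral_le_iff semiring_norm)
  then show ?thesis using True by (intro exI[of _ "\<lambda>_. 0"]) auto
next
  case False
  let ?n = "card A"
  define k where "k = (if 4 \<le> ?n \<and> ?n \<noteq> 5 then 4 else 3 :: nat)"
  obtain h where h: "bij_betw h A {0..<?n}" using ex_bij_betw_finite_nat[OF assms] by blast
  define g where "g e = h e div k" for e
  have "k > 0" unfolding k_def by simp
  have "card {e \<in> A. g e = j} \<le> k" for j
  proof -
    have "h ` {e \<in> A. g e = j} \<subseteq> {j * k..<j * k + k}"
    proof
      fix m assume "m \<in> h ` {e \<in> A. g e = j}"
      then have "m div k = j" unfolding g_def by auto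
      then show "m \<in> {j * k..<j * k + k}"
        using \<open>k > 0\<close> dividend_less_div_times[of k m] by (auto simp: div_times_less_eq_dividend)
    qed
    moreover have "inj_on h {e \<in> A. g e = j}"
      using h by (auto simp: bij_betw_def inj_on_def)
    ultimately have "card {e \<in> A. g e = j} \<le> card {j * k..<j * k + k}"
      by (metis card_image card_mono finite_atLeastLessThan)
    then show ?thesis by simp
  qed
  moreover have "card (g ` A) \<le> (?n - 1) div k + 1"
  proof -
    have "g e \<le> (?n - 1) div k" if "e \<in> A" for e
    proof -
      have "h e < ?n" using h that by (auto simp: bij_betw_def)
      then show ?thesis unfolding g_def by (intro div_le_mono) simp
    qed
    then have "g ` A \<subseteq> {..(?n - 1) div k}" by auto
    then show ?thesis using card_mono[of "{..(?n - 1) div k}" "g ` A"] by simp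
  qed
  moreover have "2 * ((?n - 1) div k + 1) + (if 4 \<le> ?n \<and> ?n \<noteq> 5 then 2 else 1) \<le> ?n"
  proof (cases "4 \<le> ?n \<and> ?n \<noteq> 5")
    case True
    then have "2 * ((?n - 1) div 4 + 1) + 2 \<le> ?n" by presburger
    then show ?thesis using True by (simp add: k_def)
  next
    case f: False
    then have "?n = 3 \<or> ?n = 5" using False by linarith
    then show ?thesis by (auto simp: k_def)
  qed
  ultimately show ?thesis using False unfolding k_def by (intro exI[of _ g]) fastforce
qed

section \<open>Vertices of degree two in an admissible graph\<close>

locale admissible_graph = finite_simple_graph V E for V :: "'a set" and E :: "'a set set" +
  assumes admissible: "admissible E"
begin

abbreviation deg :: "'a \<Rightarrow> nat" where "deg \<equiv> vdegree E"

definition star :: "'a \<Rightarrow> 'a set set" where "star v = {e \<in> E. v \<in> e}"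

definition others :: "('a set \<Rightarrow> nat) \<Rightarrow> 'a \<Rightarrow> 'a set \<Rightarrow> nat \<Rightarrow> nat" where
  "others c v e i = card {f \<in> star v - {e}. c f = i}"

text \<open>The vertices of degree at least three at which splitting leaves a positive slack.\<close>

definition good :: "'a \<Rightarrow> bool" where "good v \<longleftrightarrow> 4 \<le> deg v \<and> deg v \<noteq> 5"

text \<open>\<open>H\<close> consists of the edges that are colored last.\<close>

definition H :: "'a set set" where "H = {h \<in> E. \<forall>v\<in>h. deg v = 2}"

definition B :: "'a set set" where "B = E - H"

text \<open>The vertices of degree two that are contracted, which forces their two edges to
  share a color.\<close>

definition K :: "'a set" where
  "K = {u. deg u = 2 \<and> star u \<subseteq> B \<and> (\<exists>w. {u, w} \<in> E \<and> \<not> good w)}"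

lemma finite_edges: "finite E"
  using finite_vertices edge_subset by (meson finite_Pow_iff finite_subset PowI subsetI)

lemma finite_star: "finite (star v)"
  using finite_edges unfolding star_def by simp

lemma card_star: "card (star v) = deg v"
  unfolding star_def vdegree_def by simp

lemma star_iff: "e \<in> star v \<longleftrightarrow> e \<in> E \<and> v \<in> e"
  unfolding star_def by simp

lemma star_pairD:
  assumes "star v = {e, f}"
  shows "e \<in> E" "v \<in> e" "f \<in> E" "v \<in> f"
  using assms unfolding star_def by blast+

lemma edge_eq: "e \<in> E \<Longrightarrow> x \<in> e \<Longrightarrow> y \<in> e \<Longrightarrow> x \<noteq> y \<Longrightarrow> e = {x, y}"
  using edge_card by (rule doubleton_eq_card_2)

lemma edge_other:
  assumes "e \<in> E" "v \<in> e"
  obtains w where "e = {v, w}" "w \<noteq> v"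
  using edge_card[OF assms(1)] assms(2) that by (auto simp: card_2_iff doubleton_eq_iff)

lemma deg_pos: "e \<in> E \<Longrightarrow> v \<in> e \<Longrightarrow> deg v \<ge> 1"
  using finite_star[of v] card_star[of v] card_gt_0_iff[of "star v"]
  by (metis One_nat_def Suc_leI empty_iff star_iff)

lemma star_deg_2:
  assumes "deg v = 2" "e \<in> star v"
  obtains f where "star v = {e, f}" "f \<noteq> e"
proof -
  obtain x y where "star v = {x, y}" "x \<noteq> y"
    using assms(1) card_star[of v] by (auto simp: card_2_iff)
  then show thesis using assms(2) that[of x] that[of y] by auto
qed

lemma no_pendant_path:
  assumes "e \<in> E" "e = {u, v}" "u \<noteq> v" "deg u = 2"
  shows "deg v \<noteq> 1"
proof
  assume "deg v = 1"
  have "e \<in> star u" using assms by (simp add: star_iff)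
  then obtain f where f: "star u = {e, f}" "f \<noteq> e" using star_deg_2[OF assms(4)] by blast
  note mem = star_pairD[OF f(1)]
  then obtain z where z: "f = {u, z}" "z \<noteq> u" using edge_other[OF mem(3,4)] by blast
  have "{v, u} \<in> E" using assms by (simp add: insert_commute)
  moreover have "z \<noteq> v" using z f assms by auto
  ultimately have "v \<noteq> u \<and> u \<noteq> z \<and> v \<noteq> z \<and> {v, u} \<in> E \<and> {u, z} \<in> E \<and> deg v = 1 \<and> deg u = 2"
    using assms z mem(3) \<open>deg v = 1\<close> by simp
  then show False using admissible unfolding admissible_def by blast
qed

lemma H_iff: "h \<in> H \<longleftrightarrow> h \<in> E \<and> (\<forall>v\<in>h. deg v = 2)"
  unfolding H_def by simp

lemma B_iff: "e \<in> B \<longleftrightarrow> e \<in> E \<and> e \<notin> H"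
  unfolding B_def by simp

text \<open>Degree two would put the edge into \<open>H\<close>, and degree one is excluded by
  admissibility, which enters the construction here.\<close>

lemma B_far_degree:
  assumes "e \<in> B" "e = {u, v}" "u \<noteq> v" "deg u = 2"
  shows "deg v \<ge> 3"
proof -
  have "deg v \<noteq> 2" using assms by (auto simp: B_iff H_iff)
  moreover have "deg v \<noteq> 1" using assms no_pendant_path[of e u v] by (simp add: B_iff)
  moreover have "deg v \<ge> 1" using assms deg_pos[of e v] by (auto simp: B_iff)
  ultimately show ?thesis by linarith
qed

lemma star_subset_B: "deg v \<noteq> 2 \<Longrightarrow> star v \<subseteq> B"
  by (auto simp: star_iff B_iff H_iff)

text \<open>Neighbors of a contracted vertex have degree at least three, so contracted vertices are
  pairwise nonadjacent.\<close>

lemma K_Int_edge: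
  assumes "e \<in> E" "u \<in> K" "u \<in> e"
  shows "K \<inter> e = {u}"
proof -
  have "deg u = 2" "e \<in> B" using assms unfolding K_def by (auto simp: star_iff)
  moreover obtain v where "e = {u, v}" "v \<noteq> u" using edge_other[OF assms(1,3)] .
  ultimately have "v \<notin> K" using B_far_degree[of e u v] unfolding K_def by auto
  then show ?thesis using \<open>e = {u, v}\<close> assms by auto
qed

text \<open>Both ends of an isolated edge of \<open>H\<close> have that edge as hub, which merges
  them. An end with a second edge in \<open>H\<close> has a larger hub, so nothing is merged
  there.\<close>

definition hub :: "'a \<Rightarrow> 'a set" where "hub v = insert v (\<Union>{h \<in> H. v \<in> h})"

lemma hub_self: "v \<in> hub v"
  unfolding hub_def by simp

lemma hub_deg_not_2: "deg v \<noteq> 2 \<Longrightarrow> hub v = {v}"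
  unfolding hub_def by (auto simp: H_iff)

lemma hub_H:
  assumes "h \<in> H" "v \<in> h" "e \<in> B" "v \<in> e"
  shows "star v = {h, e}" "hub v = h"
proof -
  have mem: "deg v = 2" "h \<in> star v" and e: "e \<in> star v" "h \<noteq> e" "e \<notin> H"
    using assms by (auto simp: H_iff star_iff B_iff)
  obtain f where "star v = {h, f}" using star_deg_2[OF mem] .
  then show star: "star v = {h, e}" using e by auto
  have "h' = h" if "h' \<in> H" "v \<in> h'" for h'
    using star that \<open>e \<notin> H\<close> by (auto simp: star_def H_iff)
  then show "hub v = h" using assms unfolding hub_def by blast
qed

lemma hub_eq_imp:
  assumes "hub v = hub w" "v \<noteq> w"
  shows "{v, w} \<in> H"
proof -
  have "v \<in> hub w" using assms hub_self by blast
  then obtain h where h: "h \<in> H" "v \<in> h" "w \<in> h" using assms(2) unfolding hub_def by auto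
  then have "h = {v, w}" using assms(2) edge_eq[of h v w] by (simp add: H_iff)
  then show ?thesis using h by simp
qed

end

text \<open>The ports are the vertices of the contracted multigraph: the second component splits a
  vertex of high degree, and the first one identifies the two ends of an isolated edge of \<open>H\<close>,
  so that the edges next to it get different colors. An edge of the multigraph, called an item, is
  either an edge of the graph or a singleton \<open>{u}\<close> with \<open>u \<in> K\<close>.\<close>

locale grouped_graph = admissible_graph V E for V :: "'a set" and E :: "'a set set" +
  fixes g :: "'a \<Rightarrow> 'a set \<Rightarrow> nat"
  assumes group_trivial: "deg v \<le> 2 \<Longrightarrow> g v e = 0"
    and group_size: "card {e \<in> star v. g v e = j} \<le> (if good v then 4 else 3)"
    and group_number: "3 \<le> deg v \<Longrightarrow> 2 * card (g v ` star v) + (if good v then 2 else 1) \<le> deg v"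
begin

section \<open>Ports and items of the contracted multigraph\<close>

definition port :: "'a \<Rightarrow> 'a set \<Rightarrow> 'a set \<times> nat" where "port v e = (hub v, g v e)"

definition item :: "'a set \<Rightarrow> 'a set" where "item e = (if K \<inter> e = {} then e else K \<inter> e)"

text \<open>Ends are collected over all edges with the same item and skip \<open>K\<close>, so the
  item of a contracted vertex joins the outer ends of its two edges.\<close>

definition ends :: "'a set \<Rightarrow> ('a set \<times> nat) set" where
  "ends x = (\<Union>e\<in>{e \<in> B. item e = x}. (\<lambda>v. port v e) ` (e - K))"

definition port_edges :: "'a set \<times> nat \<Rightarrow> 'a set set" where
  "port_edges q = {e \<in> B. \<exists>v\<in>e. v \<notin> K \<and> port v e = q}"

lemma finite_B: "finite B"
  using finite_edges unfolding B_def by simp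

lemma item_K: "e \<in> B \<Longrightarrow> u \<in> K \<Longrightarrow> u \<in> e \<Longrightarrow> item e = {u}"
  using K_Int_edge[of e u] unfolding item_def by (auto simp: B_iff)

lemma item_eq_edge:
  assumes "e \<in> E" "f \<in> B" "item f = e"
  shows "f = e" "K \<inter> e = {}"
proof -
  have "K \<inter> f = {}"
  proof (rule ccontr)
    assume "K \<inter> f \<noteq> {}"
    then obtain u where "u \<in> K" "u \<in> f" by blast
    then have "e = {u}" using item_K assms by blast
    then show False using edge_card[OF assms(1)] by simp
  qed
  then show "f = e" "K \<inter> e = {}" using assms(3) unfolding item_def by auto
qed

lemma item_eq_singleton:
  assumes "f \<in> B" "item f = {u}"
  shows "u \<in> f" "u \<in> K"
proof -
  have "f \<noteq> {u}" using assms(1) edge_card[of f] by (auto simp: B_iff)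
  then have "K \<inter> f = {u}" using assms(2) unfolding item_def by (auto split: if_splits)
  then show "u \<in> f" "u \<in> K" by auto
qed

lemma port_same_vertex: "port v e = port v f \<longleftrightarrow> g v e = g v f"
  unfolding port_def by simp

text \<open>A common hub would force the edge joining the two vertices into \<open>H\<close>; this
  excludes loops at edges that are not contracted.\<close>

lemma port_neq:
  assumes "e \<in> B" "v \<in> e" "w \<in> e" "v \<noteq> w"
  shows "port v e \<noteq> port w f"
proof
  assume "port v e = port w f"
  then have "{v, w} \<in> H" using hub_eq_imp assms(4) unfolding port_def by blast
  then show False using assms edge_eq[of e v w] by (auto simp: B_iff)
qed

lemma K_star:
  assumes "u \<in> K"
  obtains v w where "star u = {{u, v}, {u, w}}" "{u, v} \<in> B" "{u, w} \<in> B"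
    "v \<noteq> u" "w \<noteq> u" "v \<noteq> w" "deg v \<ge> 3" "deg w \<ge> 3"
proof -
  have deg: "deg u = 2" and sub: "star u \<subseteq> B" using assms unfolding K_def by auto
  obtain e f where ef: "star u = {e, f}" "e \<noteq> f"
    using deg card_star[of u] by (auto simp: card_2_iff)
  note mem = star_pairD[OF ef(1)]
  have B: "e \<in> B" "f \<in> B" using sub ef by auto
  obtain v where v: "e = {u, v}" "v \<noteq> u" using edge_other[OF mem(1,2)] .
  obtain w where w: "f = {u, w}" "w \<noteq> u" using edge_other[OF mem(3,4)] .
  show thesis
    using that[of v w] v w ef B deg B_far_degree[of e u v] B_far_degree[of f u w] by auto
qed

text \<open>There are no loops: an uncontracted edge has distinct ports, and the two outer neighbors
  of a contracted vertex are distinct with singleton hubs.\<close>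

lemma card_ends:
  assumes "x \<in> item ` B"
  shows "card (ends x) = 2"
proof -
  obtain e where e: "e \<in> B" "item e = x" using assms by blast
  then have eE: "e \<in> E" by (simp add: B_iff)
  show ?thesis
  proof (cases "K \<inter> e = {}")
    case True
    then have "x = e" using e unfolding item_def by simp
    obtain v w where vw: "e = {v, w}" "v \<noteq> w"
      using edge_card[OF eE] by (auto simp: card_2_iff)
    have "{f \<in> B. item f = x} = {e}"
      using item_eq_edge(1)[OF eE] e \<open>x = e\<close> by auto
    moreover have "e - K = {v, w}" using vw True by auto
    ultimately have "ends x = {port v e, port w e}" unfolding ends_def by simp
    then show ?thesis using port_neq[of e v w e] e vw by simp
  next
    case False
    then obtain u where u: "u \<in> K" "u \<in> e" by blast
    then have x: "x = {u}" using item_K e by blast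
    obtain v w where vw: "star u = {{u, v}, {u, w}}" "{u, v} \<in> B" "{u, w} \<in> B"
      "v \<noteq> u" "w \<noteq> u" "v \<noteq> w" "deg v \<ge> 3" "deg w \<ge> 3"
      using K_star[OF u(1)] .
    have notK: "v \<notin> K" "w \<notin> K" using vw unfolding K_def by auto
    have "f \<in> {f \<in> B. item f = x} \<longleftrightarrow> f \<in> star u" for f
      using item_eq_singleton[of f u] item_K[of f u] u(1) x unfolding K_def
      by (auto simp: star_iff B_iff)
    then have "{f \<in> B. item f = x} = {{u, v}, {u, w}}" using vw(1) by blast
    moreover have "{u, v} - K = {v}" "{u, w} - K = {w}" using notK u(1) by auto
    ultimately have "ends x = {port v {u, v}, port w {u, w}}" unfolding ends_def by auto
    moreover have "port v {u, v} \<noteq> port w {u, w}"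
      using vw hub_deg_not_2[of v] hub_deg_not_2[of w] unfolding port_def by auto
    ultimately show ?thesis by simp
  qed
qed

text \<open>With a singleton hub the port is one group at \<open>v\<close>. Otherwise the hub is an
  edge of \<open>H\<close>, and each of its two ends has just one other edge.\<close>

lemma card_port_edges:
  assumes "e \<in> B" "v \<in> e" "v \<notin> K"
  shows "card (port_edges (port v e)) \<le> (if good v then 4 else 3)"
proof (cases "hub v = {v}")
  case True
  have "w = v" if "hub w = {v}" for w using that hub_self by blast
  then have "port_edges (port v e) \<subseteq> {f \<in> star v. g v f = g v e}"
    unfolding port_edges_def port_def using True by (auto simp: star_iff B_iff)
  then have "card (port_edges (port v e)) \<le> card {f \<in> star v. g v f = g v e}"
    using finite_star by (intro card_mono) auto
  then show ?thesis using group_size[of v "g v e"] by linarith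
next
  case False
  then obtain h where h: "h \<in> H" "v \<in> h" unfolding hub_def by blast
  then have hub: "hub v = h" using hub_H(2) assms(1,2) by simp
  have "h \<in> E" using h by (simp add: H_iff)
  then obtain w where w: "h = {v, w}" using edge_other[of h v] h by auto
  have two: "deg v = 2" "deg w = 2" "h \<in> star v" "h \<in> star w" using h w by (auto simp: H_iff star_iff)
  have "port_edges (port v e) \<subseteq> (star v - {h}) \<union> (star w - {h})"
  proof
    fix f assume "f \<in> port_edges (port v e)"
    then obtain y where y: "f \<in> B" "y \<in> f" "hub y = h"
      unfolding port_edges_def port_def using hub by auto
    then have "y \<in> {v, w}" using hub_self w by blast
    then show "f \<in> (star v - {h}) \<union> (star w - {h})" using y h by (auto simp: star_iff B_iff)
  qed
  then have "card (port_edges (port v e)) \<le> card ((star v - {h}) \<union> (star w - {h}))"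
    using finite_star by (intro card_mono) auto
  also have "\<dots> \<le> card (star v - {h}) + card (star w - {h})" by (rule card_Un_le)
  also have "\<dots> = 2" using two card_star[of v] card_star[of w] by simp
  finally show ?thesis by simp
qed

lemma card_port_items:
  "card {x \<in> item ` B. q \<in> ends x} \<le> card (port_edges q)"
proof -
  have "{x \<in> item ` B. q \<in> ends x} \<subseteq> item ` port_edges q"
    unfolding ends_def port_edges_def by blast
  then have "card {x \<in> item ` B. q \<in> ends x} \<le> card (item ` port_edges q)"
    using finite_B unfolding port_edges_def by (intro card_mono) auto
  also have "\<dots> \<le> card (port_edges q)"
    using finite_B unfolding port_edges_def by (intro card_image_le) auto
  finally show ?thesis .
qed

lemma card_port_items_le_4: "card {x \<in> item ` B. q \<in> ends x} \<le> 4"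
proof (cases "port_edges q = {}")
  case True
  then show ?thesis using card_port_items[of q] by simp
next
  case False
  then obtain e v where "e \<in> B" "v \<in> e" "v \<notin> K" "q = port v e" unfolding port_edges_def by blast
  then show ?thesis
    using card_port_edges[of e v] card_port_items[of q] by (auto split: if_splits)
qed

text \<open>Every vertex of \<open>K\<close> has a neighbor that is not good, so the item is not
  contracted; good vertices have singleton hubs, so the edge can be read off its ports.\<close>

lemma good_item:
  assumes "e \<in> B" "\<And>f v. f \<in> B \<Longrightarrow> item f = item e \<Longrightarrow> v \<in> f \<Longrightarrow> v \<notin> K \<Longrightarrow> good v"
  shows "item e = e" "\<Union> (fst ` ends (item e)) = e"
proof -
  have empty: "K \<inter> e = {}"
  proof (rule ccontr)
    assume "K \<inter> e \<noteq> {}"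
    then obtain u where u: "u \<in> K" "u \<in> e" by blast
    then obtain w where w: "{u, w} \<in> E" "\<not> good w" unfolding K_def by blast
    then have wB: "{u, w} \<in> B" using u(1) unfolding K_def by (auto simp: star_iff)
    have "w \<noteq> u" using edge_card[OF w(1)] by auto
    then have "w \<notin> K" using K_Int_edge[OF w(1) u(1)] by auto
    moreover have "item {u, w} = item e" using item_K u wB assms(1) by simp
    ultimately show False using assms(2)[of "{u, w}" w] w wB by simp
  qed
  then show item: "item e = e" unfolding item_def by simp
  have "hub v = {v}" if "v \<in> e" for v
  proof -
    have "v \<notin> K" using empty that by blast
    then have "deg v \<noteq> 2" using assms(2)[OF assms(1) refl that] unfolding good_def by auto
    then show ?thesis by (rule hub_deg_not_2)
  qed
  moreover have "{f \<in> B. item f = e} = {e}"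
    using item_eq_edge(1)[of e] assms(1) item by (auto simp: B_iff)
  then have "ends e = (\<lambda>v. port v e) ` e"
    using empty unfolding ends_def by (simp add: Diff_triv Int_commute)
  ultimately have "fst ` ends e = (\<lambda>v. {v}) ` e" unfolding port_def by (auto simp: image_image)
  then show "\<Union> (fst ` ends (item e)) = e" using item by simp
qed

text \<open>If all ends carried more than three items, all vertices involved would be good. Both
  items would then be edges determined by their ports, hence equal.\<close>

lemma parallel_items:
  assumes "x \<in> item ` B" "y \<in> item ` B" "x \<noteq> y" "ends x = ends y"
  shows "\<exists>q\<in>ends x. card {z \<in> item ` B. q \<in> ends z} \<le> 3"
proof (rule ccontr)
  assume "\<not> ?thesis"
  then have large: "card (port_edges q) > 3" if "q \<in> ends x" for q
    using card_port_items[of q] that by fastforce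
  have good: "good v" if "f \<in> B" "item f \<in> {x, y}" "v \<in> f" "v \<notin> K" for f v
  proof -
    have "port v f \<in> ends x" using that assms(4) unfolding ends_def by auto
    then have "card (port_edges (port v f)) > 3" by (rule large)
    then show ?thesis using card_port_edges[of f v] that by (cases "good v") auto
  qed
  obtain e f where ef: "e \<in> B" "x = item e" "f \<in> B" "y = item f" using assms(1,2) by blast
  have "item e = e" "\<Union> (fst ` ends (item e)) = e"
    using good_item[OF ef(1)] good ef by auto
  moreover have "item f = f" "\<Union> (fst ` ends (item f)) = f"
    using good_item[OF ef(3)] good ef by auto
  ultimately show False using assms(3,4) ef by metis
qed

text \<open>Each edge of \<open>B\<close> inherits the color of its item in a proper 5-coloring of
  the multigraph.\<close>

lemma base_coloring:
  obtains c :: "'a set \<Rightarrow> nat" where "c ` B \<subseteq> {..4}"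
    and "\<And>u e f. u \<in> K \<Longrightarrow> e \<in> star u \<Longrightarrow> f \<in> star u \<Longrightarrow> c e = c f"
    and "\<And>v i. deg v \<ge> 3 \<Longrightarrow>
      2 * card {e \<in> star v. c e = i} + (if good v then 2 else 1) \<le> deg v"
    and "\<And>h e f. h \<in> H \<Longrightarrow> e \<in> B \<Longrightarrow> f \<in> B \<Longrightarrow> e \<noteq> f \<Longrightarrow> e \<inter> h \<noteq> {} \<Longrightarrow> f \<inter> h \<noteq> {} \<Longrightarrow> c e \<noteq> c f"
proof -
  obtain c0 where c0: "proper_coloring ends (item ` B) 4 c0"
    using multigraph_proper_coloring[of "item ` B" ends] finite_B card_ends
      card_port_items_le_4 parallel_items by auto
  define c where "c e = c0 (item e)" for e
  have inj: "item e = item f"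
    if "e \<in> B" "f \<in> B" "v \<in> e" "w \<in> f" "v \<notin> K" "w \<notin> K" "port v e = port w f" "c e = c f"
    for e f v w
  proof (rule proper_coloringD[OF c0])
    show "port v e \<in> ends (item e)" using that unfolding ends_def by blast
    show "port v e \<in> ends (item f)" using that unfolding ends_def by blast
  qed (use that c_def in auto)
  show thesis
  proof (rule that)
    show "c ` B \<subseteq> {..4}" using c0 unfolding proper_coloring_def c_def by auto
    show "c e = c f" if "u \<in> K" "e \<in> star u" "f \<in> star u" for u e f
    proof -
      have "e \<in> B" "u \<in> e" "f \<in> B" "u \<in> f" using that unfolding K_def by (auto simp: star_iff)
      then show ?thesis using item_K that(1) unfolding c_def by simp
    qed
    show "2 * card {e \<in> star v. c e = i} + (if good v then 2 else 1) \<le> deg v"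
      if v: "deg v \<ge> 3" for v i
    proof -
      have vK: "v \<notin> K" using v unfolding K_def by auto
      \<comment> \<open>Equal color and equal group mean a shared port, so a color occurs at most
        once in each group at \<open>v\<close>.\<close>
      have "inj_on (g v) {e \<in> star v. c e = i}"
      proof (rule inj_onI)
        fix e f assume ef: "e \<in> {e \<in> star v. c e = i}" "f \<in> {e \<in> star v. c e = i}" "g v e = g v f"
        then have mem: "e \<in> B" "f \<in> B" "v \<in> e" "v \<in> f"
          using star_subset_B[of v] v by (auto simp: star_iff)
        then have item: "item e = item f" using inj[of e f v v] ef vK port_same_vertex by simp
        \<comment> \<open>Either the common item is the edge itself, or both edges contain the same
          contracted vertex besides \<open>v\<close>.\<close>
        show "e = f"
        proof (cases "K \<inter> f = {}")
          case True
          then have "item f = f" unfolding item_def by simp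
          then show ?thesis using item_eq_edge[of f e] mem item by (simp add: B_iff)
        next
          case False
          then obtain u where u: "u \<in> K" "u \<in> f" by blast
          then have "u \<in> e" using item item_K mem item_eq_singleton by metis
          moreover have "u \<noteq> v" using u vK by auto
          ultimately show ?thesis using mem u edge_eq by (metis B_iff)
        qed
      qed
      then have "card {e \<in> star v. c e = i} = card (g v ` {e \<in> star v. c e = i})"
        by (simp add: card_image)
      also have "\<dots> \<le> card (g v ` star v)" using finite_star by (intro card_mono) auto
      finally show ?thesis using group_number[OF v] by linarith
    qed
    show "c e \<noteq> c f"
      if ef: "h \<in> H" "e \<in> B" "f \<in> B" "e \<noteq> f" "e \<inter> h \<noteq> {}" "f \<inter> h \<noteq> {}" for h e f
    proof
      assume eq: "c e = c f"
      \<comment> \<open>An edge of \<open>B\<close> next to \<open>h\<close> is not contracted: its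
        end on \<open>h\<close> has an edge outside \<open>B\<close>, and its other end has degree
        at least three.\<close>
      have plain: "item e' = e' \<and> (\<exists>v\<in>e'. v \<notin> K \<and> hub v = h \<and> deg v = 2)"
        if e': "e' \<in> B" "e' \<inter> h \<noteq> {}" for e'
      proof -
        obtain v where v: "v \<in> e'" "v \<in> h" using e' by blast
        have "deg v = 2" using v ef(1) by (simp add: H_iff)
        have "h \<in> star v" using v ef(1) by (simp add: star_iff H_iff)
        then have "v \<notin> K" using ef(1) unfolding K_def by (auto simp: B_iff)
        obtain w where w: "e' = {v, w}" "w \<noteq> v" using edge_other[of e' v] e' v by (auto simp: B_iff)
        then have "deg w \<ge> 3" using B_far_degree[of e' v w] e' \<open>deg v = 2\<close> by auto
        then have "w \<notin> K" unfolding K_def by auto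
        then have "item e' = e'" using w \<open>v \<notin> K\<close> unfolding item_def by auto
        then show ?thesis using v \<open>v \<notin> K\<close> \<open>deg v = 2\<close> hub_H(2)[OF ef(1) v(2) e'(1) v(1)] by blast
      qed
      obtain v w where "v \<in> e" "v \<notin> K" "hub v = h" "deg v = 2" "w \<in> f" "w \<notin> K" "hub w = h" "deg w = 2"
        using plain[of e] plain[of f] ef by blast
      \<comment> \<open>Both ends on \<open>h\<close> have hub \<open>h\<close> and group 0, so
        their ports coincide.\<close>
      then have "item e = item f"
        using inj[of e f v w] ef eq group_trivial unfolding port_def by simp
      then show False using plain[of e] plain[of f] ef by simp
    qed
  qed
qed

end

section \<open>Coloring the remaining edges\<close>

context admissible_graph
begin

text \<open>Linked edges need different colors, since they are the only neighbors of an edge of \<open>H\<close>;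
  coloring \<open>x \<in> H\<close> with a blocked color would make a sum of two slacks negative.\<close>

definition linked :: "'a set \<Rightarrow> 'a set \<Rightarrow> bool" where
  "linked x y \<longleftrightarrow> x \<noteq> y \<and> (\<exists>h\<in>H. h \<noteq> x \<and> h \<noteq> y \<and> x \<inter> h \<noteq> {} \<and> y \<inter> h \<noteq> {})"

definition blocked :: "('a set \<Rightarrow> nat) \<Rightarrow> 'a set \<Rightarrow> nat \<Rightarrow> bool" where
  "blocked c x i \<longleftrightarrow>
     (\<exists>u\<in>x. \<exists>p\<in>B. \<exists>v\<in>p. u \<in> p \<and> v \<noteq> u \<and> deg v \<le> 2 * others c v p i + 1)"

text \<open>These are the colors that the end \<open>u\<close> forbids for an edge \<open>x\<close>
  of \<open>H\<close>. Links are read off the current coloring \<open>c\<close>, majorities off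
  \<open>c0\<close>, since the edges counted there lie in \<open>B\<close> and have their final
  colors.\<close>

definition side_colors :: "('a set \<Rightarrow> nat) \<Rightarrow> ('a set \<Rightarrow> nat) \<Rightarrow> 'a set \<Rightarrow> 'a \<Rightarrow> nat set" where
  "side_colors c c0 x u =
     c ` {y \<in> E. y \<noteq> x \<and> (\<exists>h\<in>H. h \<noteq> x \<and> h \<noteq> y \<and> u \<in> h \<and> y \<inter> h \<noteq> {})} \<union>
     {i. \<exists>p\<in>B. \<exists>v\<in>p. u \<in> p \<and> v \<noteq> u \<and> deg v \<le> 2 * others c0 v p i + 1}"

lemma linked_sym: "linked x y \<Longrightarrow> linked y x"
  unfolding linked_def by blast

text \<open>Let \<open>p\<close> be the other edge at \<open>u\<close>. If \<open>p\<close> is in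
  \<open>H\<close>, only the color of the next edge beyond \<open>p\<close> is forbidden. Otherwise
  the forbidden colors fill at least half of the other edges at the far end of \<open>p\<close>, and
  there are at most two of these.\<close>

lemma card_side_colors:
  assumes "x \<in> H" "u \<in> x"
  shows "finite (side_colors c c0 x u)" "card (side_colors c c0 x u) \<le> 2"
proof -
  have xu: "x \<in> star u" "deg u = 2" using assms by (auto simp: H_iff star_iff)
  obtain p where p: "star u = {x, p}" "p \<noteq> x" using star_deg_2[OF xu(2,1)] .
  note mem = star_pairD[OF p(1)]
  have at_u: "e = x \<or> e = p" if "e \<in> E" "u \<in> e" for e
    using that p(1) star_iff[of e u] by simp
  obtain w where w: "p = {u, w}" "w \<noteq> u" using edge_other[OF mem(3,4)] .
  have "finite (side_colors c c0 x u) \<and> card (side_colors c c0 x u) \<le> 2"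
  proof (cases "p \<in> H")
    case True
    have "side_colors c c0 x u \<subseteq> c ` (star w - {p})"
    proof
      fix i assume "i \<in> side_colors c c0 x u"
      moreover have "False" if "q \<in> B" "u \<in> q" for q
        using at_u[of q] that True assms(1) by (auto simp: B_iff)
      ultimately obtain y h where y: "y \<in> E" "y \<noteq> x" "h \<in> H" "h \<noteq> x" "h \<noteq> y" "u \<in> h"
          "y \<inter> h \<noteq> {}" "i = c y"
        unfolding side_colors_def by auto
      then have "h = p" using at_u[of h] by (auto simp: H_iff)
      then have "u \<notin> y" using at_u[of y] y by auto
      then have "w \<in> y" using y \<open>h = p\<close> w by auto
      then show "i \<in> c ` (star w - {p})" using y \<open>h = p\<close> by (auto simp: star_iff)
    qed
    moreover have "card (c ` (star w - {p})) \<le> 1"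
    proof -
      have "deg w = 2" "p \<in> star w" using True w by (auto simp: H_iff star_iff)
      then have "card (star w - {p}) = 1" using card_star[of w] by simp
      then show ?thesis using card_image_le[of "star w - {p}" c] finite_star[of w] by simp
    qed
    moreover have "finite (c ` (star w - {p}))" using finite_star by simp
    ultimately show ?thesis
      using finite_subset card_mono[of "c ` (star w - {p})" "side_colors c c0 x u"] by fastforce
  next
    case False
    let ?S = "star w - {p}"
    have pB: "p \<in> B" using False mem by (simp add: B_iff)
    have degw: "deg w \<ge> 3" using B_far_degree[OF pB w(1)] w(2) xu(2) by simp
    have "p \<in> star w" using mem w by (simp add: star_iff)
    \<comment> \<open>This off-by-one turns the blocking condition
      \<open>deg w \<le> 2 * n + 1\<close> into the majority condition on \<open>?S\<close>.\<close>
    then have cardS: "deg w = card ?S + 1"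
      using card_star[of w] degw finite_star[of w] by simp
    have "side_colors c c0 x u \<subseteq> {i. card ?S \<le> 2 * card {f \<in> ?S. c0 f = i}}"
    proof
      fix i assume "i \<in> side_colors c c0 x u"
      moreover have "False" if "h \<in> H" "h \<noteq> x" "u \<in> h" for h
        using at_u[of h] that False by (auto simp: H_iff)
      ultimately obtain q v where q: "q \<in> B" "v \<in> q" "u \<in> q" "v \<noteq> u"
          "deg v \<le> 2 * others c0 v q i + 1"
        unfolding side_colors_def by blast
      then have "q = p" using at_u[of q] assms(1) by (auto simp: B_iff)
      then have "v = w" using q w by auto
      then show "i \<in> {i. card ?S \<le> 2 * card {f \<in> ?S. c0 f = i}}"
        using q \<open>q = p\<close> cardS unfolding others_def by simp
    qed
    moreover have "?S \<noteq> {}"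
    proof
      assume "?S = {}"
      then have "card ?S = 0" by (metis card.empty)
      then show False using cardS degw by linarith
    qed
    ultimately show ?thesis
      using card_majority_colors[of ?S c0] finite_star[of w]
      by (meson card_mono finite_Diff finite_subset order_trans)
  qed
  then show "finite (side_colors c c0 x u)" "card (side_colors c c0 x u) \<le> 2" by auto
qed

text \<open>Edges of \<open>H\<close> are inserted one at a time: two ends forbid at most four
  colors, so one of five is left. Stating \<open>blocked\<close> for the fixed \<open>c0\<close>
  makes it invariant under later insertions.\<close>

lemma extend_coloring:
  assumes base: "c0 ` B \<subseteq> {..4}"
    "\<And>x y. x \<in> B \<Longrightarrow> y \<in> B \<Longrightarrow> linked x y \<Longrightarrow> c0 x \<noteq> c0 y"
    and "finite A" "A \<subseteq> H"
  shows "\<exists>c. (\<forall>e\<in>B. c e = c0 e) \<and> c ` (B \<union> A) \<subseteq> {..4} \<and>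
    (\<forall>x\<in>B \<union> A. \<forall>y\<in>B \<union> A. linked x y \<longrightarrow> c x \<noteq> c y) \<and> (\<forall>x\<in>A. \<not> blocked c0 x (c x))"
  using assms(3,4)
proof (induction A rule: finite_induct)
  case empty
  then show ?case using base by (intro exI[of _ c0]) auto
next
  case (insert x A)
  then obtain c where c: "\<forall>e\<in>B. c e = c0 e" "c ` (B \<union> A) \<subseteq> {..4}"
      "\<forall>x\<in>B \<union> A. \<forall>y\<in>B \<union> A. linked x y \<longrightarrow> c x \<noteq> c y" "\<forall>x\<in>A. \<not> blocked c0 x (c x)"
    by auto
  have xH: "x \<in> H" using insert.prems by simp
  then have "x \<in> E" by (simp add: H_iff)
  then obtain u v where x: "x = {u, v}" using edge_card[of x] by (auto simp: card_2_iff)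
  let ?F = "side_colors c c0 x u \<union> side_colors c c0 x v"
  have fin: "finite ?F" using card_side_colors(1)[OF xH] x by simp
  have "card ?F \<le> card (side_colors c c0 x u) + card (side_colors c c0 x v)" by (rule card_Un_le)
  also have "\<dots> \<le> 4" using card_side_colors(2)[OF xH, of u c c0]
      card_side_colors(2)[OF xH, of v c c0] x by simp
  finally obtain i where i: "i \<le> 4" "i \<notin> ?F" using exists_avoiding_color[OF fin] by blast
  have avoid: "c y \<noteq> i" if y: "y \<in> E" "linked x y" for y
  proof -
    obtain h w where "h \<in> H" "h \<noteq> x" "h \<noteq> y" "y \<noteq> x" "w \<in> x" "w \<in> h" "y \<inter> h \<noteq> {}"
      using y(2) unfolding linked_def by blast
    then have "c y \<in> side_colors c c0 x w" using y(1) unfolding side_colors_def by blast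
    then show ?thesis using i(2) x \<open>w \<in> x\<close> by auto
  qed
  have free: "\<not> blocked c0 x i"
  proof
    assume "blocked c0 x i"
    then obtain w where w: "w \<in> x"
      "\<exists>p\<in>B. \<exists>v\<in>p. w \<in> p \<and> v \<noteq> w \<and> deg v \<le> 2 * others c0 v p i + 1"
      unfolding blocked_def by blast
    from w(2) have "i \<in> side_colors c c0 x w" unfolding side_colors_def by simp
    then show False using i(2) x w(1) by auto
  qed
  have "x \<notin> B" using xH by (simp add: B_iff)
  let ?c = "c(x := i)"
  have sub: "B \<union> A \<subseteq> E" using insert.prems by (auto simp: B_iff H_iff)
  have "?c y \<noteq> ?c z" if yz: "y \<in> B \<union> insert x A" "z \<in> B \<union> insert x A" "linked y z" for y z
  proof -
    have "y \<noteq> z" using yz(3) unfolding linked_def by blast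
    consider "y = x" "z \<in> B \<union> A" "z \<noteq> x" | "z = x" "y \<in> B \<union> A" "y \<noteq> x"
      | "y \<noteq> x" "z \<noteq> x" "y \<in> B \<union> A" "z \<in> B \<union> A"
      using yz \<open>y \<noteq> z\<close> by blast
    then show ?thesis
    proof cases
      case 1
      then show ?thesis using avoid[of z] sub yz(3) by auto
    next
      case 2
      then show ?thesis using avoid[of y] sub linked_sym[OF yz(3)] by auto
    next
      case 3
      then show ?thesis using c(3) yz(3) by simp
    qed
  qed
  moreover have "\<forall>e\<in>B. ?c e = c0 e" using c(1) \<open>x \<notin> B\<close> by auto
  moreover have "?c ` (B \<union> insert x A) \<subseteq> {..4}" using c(2) i(1) by auto
  moreover have "\<forall>y\<in>insert x A. \<not> blocked c0 y (?c y)" using c(4) free by auto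
  ultimately show ?case by (intro exI[of _ ?c]) blast
qed

section \<open>Sums of slacks along an edge\<close>

lemma card_adjacent_edges:
  assumes "{u, v} \<in> E"
  shows "card {f \<in> E. card ({u, v} \<inter> f) = 1 \<and> c f = i}
    \<le> others c u {u, v} i + others c v {u, v} i"
proof -
  have "{f \<in> E. card ({u, v} \<inter> f) = 1 \<and> c f = i}
      \<subseteq> {f \<in> star u - {{u, v}}. c f = i} \<union> {f \<in> star v - {{u, v}}. c f = i}"
  proof
    fix f assume "f \<in> {f \<in> E. card ({u, v} \<inter> f) = 1 \<and> c f = i}"
    then have f: "f \<in> E" "card ({u, v} \<inter> f) = 1" "c f = i" by auto
    then have "{u, v} \<inter> f \<noteq> {}" by (metis card.empty zero_neq_one)
    then have "f \<in> star u \<or> f \<in> star v" using f(1) by (auto simp: star_iff)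
    moreover have "f \<noteq> {u, v}" using f(2) edge_card[OF assms] by (metis Int_absorb numeral_eq_one_iff semiring_norm(85))
    ultimately show "f \<in> {f \<in> star u - {{u, v}}. c f = i} \<union> {f \<in> star v - {{u, v}}. c f = i}"
      using f(3) by blast
  qed
  then have "card {f \<in> E. card ({u, v} \<inter> f) = 1 \<and> c f = i}
      \<le> card ({f \<in> star u - {{u, v}}. c f = i} \<union> {f \<in> star v - {{u, v}}. c f = i})"
    using finite_star by (intro card_mono) auto
  also have "\<dots> \<le> others c u {u, v} i + others c v {u, v} i"
    unfolding others_def by (rule card_Un_le)
  finally show ?thesis .
qed

lemma others_deg_2:
  assumes "star u = {e, f}" "f \<noteq> e"
  shows "others c u e i = (if c f = i then 1 else 0)"
proof -
  have "{x \<in> star u - {e}. c x = i} = (if c f = i then {f} else {})" using assms by auto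
  then show ?thesis unfolding others_def by simp
qed

lemma others_less:
  assumes "e \<in> E" "v \<in> e"
  shows "others c v e i < deg v"
proof -
  have "others c v e i \<le> card (star v - {e})"
    unfolding others_def using finite_star by (intro card_mono) auto
  also have "\<dots> < deg v"
    using assms card_Diff1_less[OF finite_star, of e v] card_star[of v] by (simp add: star_iff)
  finally show ?thesis .
qed

lemma others_le: "others c v e i \<le> card {f \<in> star v. c f = i}"
  unfolding others_def using finite_star by (intro card_mono) auto

text \<open>If the other edge \<open>f\<close> at \<open>u\<close> avoids color \<open>i\<close>,
  the slack 1 at \<open>u\<close> covers the worst case -1 at \<open>v\<close>. Otherwise
  \<open>v\<close> must have slack at least 1: from linked edges if \<open>v\<close> has degree two,
  from the stronger bound if \<open>v\<close> is good, from the unblocked color of \<open>f\<close>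
  if \<open>f\<close> is in \<open>H\<close>, and else from the contraction of
  \<open>u\<close>.\<close>

lemma adjacent_color_bound_deg_2:
  assumes valid: "\<And>v i. deg v \<ge> 3 \<Longrightarrow>
      2 * card {e \<in> star v. c e = i} + (if good v then 2 else 1) \<le> deg v"
    and contracted: "\<And>u e f. u \<in> K \<Longrightarrow> e \<in> star u \<Longrightarrow> f \<in> star u \<Longrightarrow> c e = c f"
    and linked: "\<And>x y. x \<in> E \<Longrightarrow> y \<in> E \<Longrightarrow> linked x y \<Longrightarrow> c x \<noteq> c y"
    and unblocked: "\<And>x. x \<in> H \<Longrightarrow> \<not> blocked c x (c x)"
    and e: "{u, v} \<in> E" and u: "deg u = 2"
  shows "2 * (others c u {u, v} i + others c v {u, v} i) + 2 \<le> deg u + deg v"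
proof -
  let ?e = "{u, v}"
  have "u \<noteq> v" using edge_card[OF e] by auto
  have "?e \<in> star u" using e by (simp add: star_iff)
  then obtain f where f: "star u = {?e, f}" "f \<noteq> ?e" using star_deg_2[OF u] by blast
  note mem = star_pairD[OF f(1)]
  have nu: "others c u ?e i = (if c f = i then 1 else 0)" using others_deg_2[OF f] .
  have small: "2 * others c v ?e i \<le> deg v"
  proof (cases "deg v \<ge> 3")
    case True
    then show ?thesis using valid[OF True, of i] others_le[of c v ?e i] by linarith
  next
    case False
    then show ?thesis using others_less[OF e, of v c i] by simp
  qed
  show ?thesis
  proof (cases "c f = i")
    case False
    then show ?thesis using nu small u by simp
  next
    case True
    have "2 * others c v ?e i + 2 \<le> deg v"
    proof (cases "deg v = 2")
      case True
      have "?e \<in> star v" using e by (simp add: star_iff)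
      then obtain f' where f': "star v = {?e, f'}" "f' \<noteq> ?e" using star_deg_2[OF True] by blast
      note mem' = star_pairD[OF f'(1)]
      have "f \<noteq> f'" using edge_eq[of f u v] mem mem' \<open>u \<noteq> v\<close> f by auto
      moreover have "?e \<in> H" using e u True by (simp add: H_iff)
      moreover have "f \<inter> ?e \<noteq> {}" "f' \<inter> ?e \<noteq> {}" using mem(4) mem'(4) by auto
      ultimately have "linked f f'" unfolding linked_def using f(2) f'(2) by metis
      then have "c f \<noteq> c f'" by (rule linked[OF mem(3) mem'(3)])
      then have "c f' \<noteq> i" using \<open>c f = i\<close> by simp
      then show ?thesis using others_deg_2[OF f'] True by simp
    next
      case False
      then have eB: "?e \<in> B" using e by (simp add: B_iff H_iff)
      then have v3: "deg v \<ge> 3" using B_far_degree[OF eB refl] \<open>u \<noteq> v\<close> u by simp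
      show ?thesis
      proof (cases "good v")
        case True
        then show ?thesis using valid[OF v3, of i] others_le[of c v ?e i] by simp
      next
        case False
        show ?thesis
        proof (cases "f \<in> H")
          case True
          have "blocked c f (c f)" if "deg v \<le> 2 * others c v ?e (c f) + 1"
            unfolding blocked_def
            by (rule bexI[of _ u], rule bexI[of _ ?e], rule bexI[of _ v])
              (use that eB mem(4) \<open>u \<noteq> v\<close> in auto)
          then have "\<not> deg v \<le> 2 * others c v ?e (c f) + 1" using unblocked[OF True] by blast
          then show ?thesis using \<open>c f = i\<close> by simp
        next
          case f_notin: False
          then have "star u \<subseteq> B" using f eB mem by (simp add: B_iff)
          then have "u \<in> K" using u e False unfolding K_def by (intro CollectI conjI exI[of _ v])
          \<comment> \<open>The edge itself has color \<open>i\<close> but is not counted in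
            \<open>others\<close>, which gains two units of slack at \<open>v\<close>.\<close>
          then have "c ?e = i" using contracted[of u ?e f] f \<open>c f = i\<close> by simp
          then have "{f \<in> star v. c f = i} = insert ?e {f \<in> star v - {?e}. c f = i}"
            using e by (auto simp: star_iff)
          then have "card {f \<in> star v. c f = i} = others c v ?e i + 1"
            using finite_star unfolding others_def by simp
          then show ?thesis using valid[OF v3, of i] by (simp split: if_splits)
        qed
      qed
    qed
    then show ?thesis using nu u True by simp
  qed
qed

text \<open>Vertices of degree other than two have nonnegative slack, so only edges with an end of
  degree two need the finer analysis.\<close>

lemma adjacent_color_bound:
  assumes "\<And>v i. deg v \<ge> 3 \<Longrightarrow>
      2 * card {e \<in> star v. c e = i} + (if good v then 2 else 1) \<le> deg v"
    and "\<And>u e f. u \<in> K \<Longrightarrow> e \<in> star u \<Longrightarrow> f \<in> star u \<Longrightarrow> c e = c f"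
    and "\<And>x y. x \<in> E \<Longrightarrow> y \<in> E \<Longrightarrow> linked x y \<Longrightarrow> c x \<noteq> c y"
    and "\<And>x. x \<in> H \<Longrightarrow> \<not> blocked c x (c x)"
    and e: "{u, v} \<in> E"
  shows "2 * (others c u {u, v} i + others c v {u, v} i) + 2 \<le> deg u + deg v"
proof -
  have half: "2 * others c w {u, v} i + 1 \<le> deg w" if "deg w \<noteq> 2" "w \<in> {u, v}" for w
  proof (cases "deg w \<ge> 3")
    case True
    then show ?thesis
      using assms(1)[OF True, of i] others_le[of c w "{u, v}" i] by (simp split: if_splits)
  next
    case False
    then show ?thesis using that others_less[OF e that(2), of c i] by simp
  qed
  consider "deg u = 2" | "deg v = 2" | "deg u \<noteq> 2" "deg v \<noteq> 2" by blast
  then show ?thesis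
  proof cases
    case 1
    show ?thesis by (rule adjacent_color_bound_deg_2[OF _ _ _ _ e 1]) (fact assms)+
  next
    case 2
    have "{v, u} \<in> E" using e by (simp add: insert_commute)
    then have "2 * (others c v {v, u} i + others c u {v, u} i) + 2 \<le> deg v + deg u"
      by (rule adjacent_color_bound_deg_2[OF _ _ _ _ _ 2, rotated 4]) (fact assms)+
    then show ?thesis by (simp add: insert_commute add.commute)
  next
    case 3
    then show ?thesis using half[of u] half[of v] by simp
  qed
qed

end

context grouped_graph
begin

text \<open>The extension to \<open>H\<close> keeps all colors on \<open>B\<close>, so the bounds at
  large vertices and the equalities at \<open>K\<close> survive; \<open>Suc\<close> shifts the
  palette from 0..4 to 1..5.\<close>

lemma strong_majority_coloring_exists:
  "\<exists>c :: 'a set \<Rightarrow> nat. strong_majority_edge_coloring E {1, 2, 3, 4, 5} c"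
proof -
  obtain c0 :: "'a set \<Rightarrow> nat" where c0: "c0 ` B \<subseteq> {..4}"
    and contracted: "\<And>u e f. u \<in> K \<Longrightarrow> e \<in> star u \<Longrightarrow> f \<in> star u \<Longrightarrow> c0 e = c0 f"
    and valid: "\<And>v i. deg v \<ge> 3 \<Longrightarrow>
      2 * card {e \<in> star v. c0 e = i} + (if good v then 2 else 1) \<le> deg v"
    and proper: "\<And>h e f. h \<in> H \<Longrightarrow> e \<in> B \<Longrightarrow> f \<in> B \<Longrightarrow> e \<noteq> f \<Longrightarrow> e \<inter> h \<noteq> {} \<Longrightarrow>
      f \<inter> h \<noteq> {} \<Longrightarrow> c0 e \<noteq> c0 f"
    by (rule base_coloring, rule that) (assumption | blast)+
  have "c0 x \<noteq> c0 y" if "x \<in> B" "y \<in> B" "linked x y" for x y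
    using that proper unfolding linked_def by blast
  moreover have "finite H" using finite_edges unfolding H_def by simp
  ultimately obtain c where c: "\<forall>e\<in>B. c e = c0 e" "c ` (B \<union> H) \<subseteq> {..4}"
      "\<forall>x\<in>B \<union> H. \<forall>y\<in>B \<union> H. linked x y \<longrightarrow> c x \<noteq> c y" "\<forall>x\<in>H. \<not> blocked c0 x (c x)"
    using extend_coloring[OF c0, of H] by blast
  have E: "B \<union> H = E" by (auto simp: B_iff H_iff)
  have agree: "c e = c0 e" if "deg v \<noteq> 2" "e \<in> star v" for v e
    using that star_subset_B c(1) by blast
  have "2 * card {e \<in> star v. c e = i} + (if good v then 2 else 1) \<le> deg v" if v: "deg v \<ge> 3" for v i
  proof -
    have "{e \<in> star v. c e = i} = {e \<in> star v. c0 e = i}" using agree[of v] v by auto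
    then show ?thesis using valid[OF v, of i] by simp
  qed
  moreover have "c e = c f" if "u \<in> K" "e \<in> star u" "f \<in> star u" for u e f
  proof -
    have "e \<in> B" "f \<in> B" using that unfolding K_def by auto
    then show ?thesis using contracted[OF that] c(1) by simp
  qed
  moreover have "c x \<noteq> c y" if "x \<in> E" "y \<in> E" "linked x y" for x y
    using that c(3) E by simp
  moreover have "\<not> blocked c x (c x)" if "x \<in> H" for x
  proof
    assume "blocked c x (c x)"
    then obtain u p v where p: "u \<in> x" "p \<in> B" "v \<in> p" "u \<in> p" "v \<noteq> u"
        "deg v \<le> 2 * others c v p (c x) + 1"
      unfolding blocked_def by blast
    have "p = {u, v}" using edge_eq[of p u v] p by (simp add: B_iff)
    moreover have "deg u = 2" using p(1) that by (simp add: H_iff)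
    ultimately have "deg v \<noteq> 2" using B_far_degree[of p u v] p by simp
    \<comment> \<open>The far end \<open>v\<close> has only edges of \<open>B\<close>, so being
      blocked means the same for \<open>c\<close> and \<open>c0\<close>.\<close>
    then have "{f \<in> star v - {p}. c f = c x} = {f \<in> star v - {p}. c0 f = c x}"
      using agree[of v] by auto
    then have "others c v p (c x) = others c0 v p (c x)" unfolding others_def by simp
    then have "blocked c0 x (c x)" using p unfolding blocked_def by metis
    then show False using c(4) that by blast
  qed
  ultimately have slack: "2 * (others c u {u, v} i + others c v {u, v} i) + 2 \<le> deg u + deg v"
    if "{u, v} \<in> E" for u v i
    using adjacent_color_bound[of c u v i] that by blast
  have "strong_majority_edge_coloring E {1, 2, 3, 4, 5} (Suc \<circ> c)"
    unfolding strong_majority_edge_coloring_def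
  proof (intro conjI allI impI ballI)
    have "Suc (c e) \<in> {1, 2, 3, 4, 5}" if "e \<in> E" for e
    proof -
      have "c e \<in> {..4}" using c(2) E that by blast
      then have "c e = 0 \<or> c e = 1 \<or> c e = 2 \<or> c e = 3 \<or> c e = 4" by (simp, linarith)
      then show ?thesis by auto
    qed
    then show "(Suc \<circ> c) ` E \<subseteq> {1, 2, 3, 4, 5}"
      by (simp only: image_subset_iff comp_apply) blast
  next
    fix u v and i :: nat
    assume e: "{u, v} \<in> E" and "i \<in> {1, 2, 3, 4, 5}"
    then obtain k where k: "i = Suc k" by (cases i) auto
    have "2 * card {f \<in> E. card ({u, v} \<inter> f) = 1 \<and> c f = k} + 2 \<le> deg u + deg v"
    proof (rule order_trans)
      show "2 * card {f \<in> E. card ({u, v} \<inter> f) = 1 \<and> c f = k} + 2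
          \<le> 2 * (others c u {u, v} k + others c v {u, v} k) + 2"
        by (intro add_right_mono mult_le_mono2 card_adjacent_edges e)
    qed (rule slack[OF e])
    then show "real (card {f \<in> E. card ({u, v} \<inter> f) = 1 \<and> (Suc \<circ> c) f = i})
        \<le> (real (deg u) + real (deg v)) / 2 - 1"
      unfolding k by (simp add: field_simps flip: of_nat_add)
  qed
  then show ?thesis by blast
qed

end

theorem theorem2:
  fixes V :: "'a set" and E :: "'a set set"
  assumes "finite_simple_graph V E"
    and "admissible E"
  shows "Maj' E \<le> 5
    \<and> (\<exists>c :: 'a set \<Rightarrow> nat. strong_majority_edge_coloring E {1, 2, 3, 4, 5} c)"
proof -
  interpret admissible_graph V E
    using assms by (simp add: admissible_graph_def admissible_graph_axioms_def)
  let ?P = "\<lambda>v g. (vdegree E v \<le> 2 \<longrightarrow> (\<forall>e. g e = (0 :: nat))) \<and>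
    (\<forall>j. card {e \<in> star v. g e = j} \<le> (if good v then 4 else 3)) \<and>
    (3 \<le> vdegree E v \<longrightarrow> 2 * card (g ` star v) + (if good v then 2 else 1) \<le> vdegree E v)"
  have "\<forall>v. \<exists>g. ?P v g"
    using exists_grouping[OF finite_star] unfolding card_star good_def by blast
  then obtain g where g: "\<forall>v. ?P v (g v)" by (rule choice[THEN exE])
  interpret grouped_graph V E g
    by unfold_locales (use g in auto)
  have ex: "\<exists>c :: 'a set \<Rightarrow> nat. strong_majority_edge_coloring E {1, 2, 3, 4, 5} c"
    by (rule strong_majority_coloring_exists)
  have "Maj' E \<le> enat (card {1, 2, 3, 4, 5 :: nat})"
    unfolding Maj'_def using ex by (intro Inf_lower CollectI exI[of _ "{1, 2, 3, 4, 5}"]) auto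
  moreover have "card {1, 2, 3, 4, 5 :: nat} = 5" by simp
  ultimately show ?thesis using ex by (metis numeral_eq_enat)
qed

end
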